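(* Let $X$ be a real Banach space, let $(x_n)_{n\in\mathbb{N}}$ be a bounded sequence in $X$, and let $\varepsilon>0$. Suppose that $(x_n)$ admits $\varepsilon$-$\ell^1$-blocks. Then there is a subsequence $(x_{n_k})_k$ of $(x_n)$ such that $$\limsup_{k\to\infty} x'(x_{n_k})-\liminf_{k\to\infty} x'(x_{n_k})\le 2\varepsilon$$ for every $x'\in X'$ with $\|x'\|=1$.
   Context: $X'$ denotes the dual space of continuous linear functionals on $X$. Let $\mathbb{K}$ be the scalar field (here $\mathbb{K}=\mathbb{R}$). A bounded sequence $(x_n)$ in a Banach space over $\mathbb{K}$ is said to admit $\varepsilon$-$\ell^1$-blocks if for every infinite set $M\subset\mathbb{N}$ there are an $r\in\mathbb{N}$, scalars $a_1,\ldots,a_r\in\mathbb{K}$ with $\sum_{\rho=1}^r|a_\rho|=1$, and indices $i_1<\cdots<i_r$ in $M$ such that $\bigl\|\sum_{\rho=1}^r a_\rho x_{i_\rho}\bigr\|\le\varepsilon$. *)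

theory Defs
  imports "HOL-Analysis.Analysis"
begin

(* Only the values of i and a on {1..r} matter. The norming condition rules out r = 0. *)
definition admits_l1_blocks :: "real \<Rightarrow> (nat \<Rightarrow> 'a::real_normed_vector) \<Rightarrow> bool" where
  "admits_l1_blocks \<epsilon> x \<longleftrightarrow>
    (\<forall>M::nat set. infinite M \<longrightarrow>
      (\<exists>(r::nat) (a::nat \<Rightarrow> real) (i::nat \<Rightarrow> nat).
        (\<Sum>\<rho>=1..r. \<bar>a \<rho>\<bar>) = 1 \<and>
        strict_mono_on {1..r} i \<and> i ` {1..r} \<subseteq> M \<and>
        norm (\<Sum>\<rho>=1..r. a \<rho> *\<^sub>R x (i \<rho>)) \<le> \<epsilon>))"

end

theory Submission
  imports Defs "HOL-Library.Diagonal_Subsequence"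
begin

text \<open>
  The theorem is a quantitative form of Rosenthal's \<open>\<ell>\<^sup>1\<close>-theorem, and its heart is combinatorial.
  Fix reals \<open>l < u\<close> with \<open>u - l > 2 * \<epsilon>\<close> and consider, for each \<open>n\<close>, the two sets of functionals
  in the dual unit ball that exceed \<open>u\<close> at \<open>x n\<close> or are below \<open>l\<close> there. If for every
  further subsequence of some subsequence a functional were infinitely often in a set of the first
  kind and infinitely often in one of the second kind, a splitting argument
  (\<open>split_hereditarily_oscillating\<close>, iterated in \<open>ex_independent_subset\<close>) would produce an
  infinite index set \<open>H\<close> on which the pairs are Boolean independent: any prescribed pattern of
  ``above \<open>u\<close>'' and ``below \<open>l\<close>'' on finitely many indices in \<open>H\<close> is realized.

  Independence contradicts \<open>\<epsilon>\<close>-blocks. Given a block \<open>v = (\<Sum> a \<rho> x (i \<rho>))\<close> over \<open>H\<close>, let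
  \<open>f\<close> follow the signs of the coefficients and \<open>g\<close> the opposite signs. Then
  \<open>f v - g v \<ge> (\<Sum> \<bar>a \<rho>\<bar>) (u - l) = u - l > 2 * \<epsilon>\<close>, whereas \<open>norm v \<le> \<epsilon>\<close> forces
  \<open>f v - g v \<le> 2 * \<epsilon>\<close>. Using two functionals is what yields the constant \<open>2 * \<epsilon>\<close>.

  Thus every subsequence has a further subsequence on which no functional oscillates across the
  gap \<open>(l, u)\<close>. A diagonal argument over the countably many rational gaps of width greater than
  \<open>2 * \<epsilon>\<close> gives one subsequence that serves all of them, and an upper and a lower limit
  more than \<open>2 * \<epsilon>\<close> apart would leave room for such a rational gap between them.
\<close>

text \<open>
  The sets \<open>A True n\<close> and \<open>A False n\<close> play the roles of ``large at \<open>n\<close>'' and ``small at \<open>n\<close>''.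
  Quantifying over all infinite subsets of \<open>N\<close> makes the notion pass to subsets of \<open>N\<close>, which the
  iteration below relies on; the witness may vary with the subset.
\<close>
definition hereditarily_oscillating ::
    "(bool \<Rightarrow> nat \<Rightarrow> 't set) \<Rightarrow> nat set \<Rightarrow> 't set \<Rightarrow> bool" where
  "hereditarily_oscillating A N S \<longleftrightarrow>
    (\<forall>N'\<subseteq>N. infinite N' \<longrightarrow> (\<exists>t\<in>S. \<forall>b. infinite {n \<in> N'. t \<in> A b n}))"

text \<open>
  Suppose that every choice of \<open>n\<close> and of a tail fails, because some piece \<open>S \<inter> A b n\<close> is
  bad on a smaller infinite set. Iterating the failure gives indices \<open>n 0 < n 1 < \<dots>\<close> with shrinking
  sets, and by the pigeonhole principle the same \<open>S\<close> and \<open>b\<close> are to blame for infinitely many of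
  them. On the set of those indices no point \<open>t\<close> of \<open>S\<close> can oscillate: either \<open>t\<close> is in none of the
  sets \<open>A b (n j)\<close>, or it is in one of them, and then it does not oscillate on the tail after \<open>n j\<close>.
\<close>
lemma split_hereditarily_oscillating:
  fixes A :: "bool \<Rightarrow> nat \<Rightarrow> 't set"
  assumes fin: "finite \<S>" and inf: "infinite N"
    and osc: "\<And>S. S \<in> \<S> \<Longrightarrow> hereditarily_oscillating A N S"
  shows "\<exists>n\<in>N. \<exists>N'\<subseteq>N. infinite N' \<and> N' \<subseteq> {n<..} \<and>
    (\<forall>S\<in>\<S>. \<forall>b. hereditarily_oscillating A N' (S \<inter> A b n))"
proof (rule ccontr)
  assume neg: "\<not> ?thesis"
  \<comment> \<open>The pair \<open>c\<close> consists of the set \<open>S\<close> and the sign \<open>b\<close> that are to blame for the failure at \<open>n\<close>.\<close>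
  define bad where "bad L n L' c \<longleftrightarrow> n \<in> L \<and> L' \<subseteq> L \<and> infinite L' \<and> L' \<subseteq> {n<..} \<and> fst c \<in> \<S> \<and>
      (\<forall>t\<in>fst c \<inter> A (snd c) n. \<exists>b. finite {m \<in> L'. t \<in> A b m})" for L n L' c
  have ex_bad: "\<exists>n L' c. bad L n L' c" if L: "L \<subseteq> N" "infinite L" for L
  proof -
    obtain n where n: "n \<in> L" using L(2) by fastforce
    have "L \<inter> {n<..} = L - {..n}" by auto
    then have tail: "infinite (L \<inter> {n<..})" using L(2) by simp
    obtain S b where Sb: "S \<in> \<S>" "\<not> hereditarily_oscillating A (L \<inter> {n<..}) (S \<inter> A b n)"
    proof -
      have "n \<in> N" "L \<inter> {n<..} \<subseteq> N" "L \<inter> {n<..} \<subseteq> {n<..}" using n L(1) by auto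
      with neg tail have "\<not> (\<forall>S\<in>\<S>. \<forall>b. hereditarily_oscillating A (L \<inter> {n<..}) (S \<inter> A b n))"
        by blast
      then show thesis using that by blast
    qed
    have "\<exists>L'\<subseteq>L \<inter> {n<..}. infinite L' \<and> (\<forall>t\<in>S \<inter> A b n. \<exists>b'. finite {m \<in> L'. t \<in> A b' m})"
      using Sb(2) unfolding hereditarily_oscillating_def by simp
    then obtain L' where "L' \<subseteq> L \<inter> {n<..}" "infinite L'"
      "\<forall>t\<in>S \<inter> A b n. \<exists>b'. finite {m \<in> L'. t \<in> A b' m}"
      by (elim exE conjE)
    then have "bad L n L' (S, b)"
      using n Sb(1) by (auto simp: bad_def)
    then show ?thesis by blast
  qed
  define P where "P z \<longleftrightarrow> (case z of (n, L, c) \<Rightarrow> \<exists>L0\<subseteq>N. bad L0 n L c)" for z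
  define Q where "Q z z' \<longleftrightarrow> (case z of (n::nat, L, c::'t set \<times> bool) \<Rightarrow>
      case z' of (n', L', c') \<Rightarrow> bad L n' L' c')" for z z'
  have "\<exists>f. \<forall>k. P (f k) \<and> Q (f k) (f (Suc k))"
  proof (rule dependent_nat_choice, goal_cases)
    case 1
    obtain n L c where "bad N n L c" using ex_bad[OF order_refl inf] by blast
    then show ?case by (intro exI[of _ "(n, L, c)"]) (auto simp: P_def)
  next
    case (2 z k)
    obtain n L c where z: "z = (n, L, c)" by (cases z)
    with 2 obtain L0 where "L0 \<subseteq> N" "bad L0 n L c" by (auto simp: P_def)
    then have L: "L \<subseteq> N" "infinite L" by (auto simp: bad_def)
    then obtain n' L' c' where "bad L n' L' c'" using ex_bad by blast
    then show ?case using L(1) z by (intro exI[of _ "(n', L', c')"]) (auto simp: P_def Q_def)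
  qed
  then obtain f where f: "\<And>k. P (f k)" "\<And>k. Q (f k) (f (Suc k))" by blast
  define n L c where "n k = fst (f k)" and "L k = fst (snd (f k))" and "c k = snd (snd (f k))" for k
  have bad0: "\<exists>L0\<subseteq>N. bad L0 (n k) (L k) (c k)" for k
    using f(1)[of k] by (simp add: P_def n_def L_def c_def split: prod.splits)
  have bad_Suc: "bad (L k) (n (Suc k)) (L (Suc k)) (c (Suc k))" for k
    using f(2)[of k] by (simp add: Q_def n_def L_def c_def split: prod.splits)
  have "decseq L" unfolding decseq_Suc_iff using bad_Suc by (auto simp: bad_def)
  have later: "n k \<in> L j" if less: "j < k" for j k
  proof -
    obtain k' where k: "k = Suc k'" "j \<le> k'" using less_imp_Suc_add[OF less] by auto
    have "n k \<in> L k'" using bad_Suc k by (simp add: bad_def)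
    then show ?thesis using decseqD[OF \<open>decseq L\<close> k(2)] by blast
  qed
  have "strict_mono n"
  proof (rule strict_monoI)
    fix j k :: nat assume "j < k"
    then show "n j < n k" using later[of j k] bad0[of j] by (auto simp: bad_def)
  qed
  have c_in: "c k \<in> \<S> \<times> UNIV" for k
    using bad0[of k] by (auto simp: bad_def mem_Times_iff)
  have "finite (range c)"
  proof (rule finite_subset)
    show "range c \<subseteq> \<S> \<times> UNIV" using c_in by blast
    show "finite (\<S> \<times> (UNIV :: bool set))" using fin by simp
  qed
  then obtain k0 where "infinite {k. c k = c k0}"
    using pigeonhole_infinite[of UNIV c] by auto
  moreover obtain S b where Sb: "c k0 = (S, b)" by (cases "c k0")
  ultimately have J: "infinite {k. c k = (S, b)}" (is "infinite ?J") by simp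
  have "S \<in> \<S>" using c_in[of k0] Sb by simp
  have P: "infinite (n ` ?J)"
    using J finite_imageD strict_mono_imp_inj_on[OF \<open>strict_mono n\<close>] inj_on_subset by blast
  have "n ` ?J \<subseteq> N"
    using bad0 by (fastforce simp: bad_def)
  then obtain t where t: "t \<in> S" "\<And>b. infinite {m \<in> n ` ?J. t \<in> A b m}"
    using osc[OF \<open>S \<in> \<S>\<close>] P unfolding hereditarily_oscillating_def by blast
  have "{m \<in> n ` ?J. t \<in> A b m} \<noteq> {}" using t(2)[of b] by (metis finite.emptyI)
  then obtain j where j: "c j = (S, b)" "t \<in> A b (n j)" by auto
  then have "\<exists>b'. finite {m \<in> L j. t \<in> A b' m}"
    using bad0[of j] t(1) by (auto simp: bad_def)
  then obtain b' where b': "finite {m \<in> L j. t \<in> A b' m}" ..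
  have "{m \<in> n ` ?J. t \<in> A b' m} \<subseteq> {m \<in> L j. t \<in> A b' m} \<union> n ` {..j}"
  proof
    fix m assume m: "m \<in> {m \<in> n ` ?J. t \<in> A b' m}"
    then obtain k where "m = n k" by auto
    then show "m \<in> {m \<in> L j. t \<in> A b' m} \<union> n ` {..j}"
      using m later[of j k] by (cases "j < k") auto
  qed
  then show False
    using t(2)[of b'] b' by (meson finite_UnI finite_atMost finite_imageI finite_subset)
qed

text \<open>
  Applying the splitting step repeatedly to the finite family of all cells obtained so far cuts
  each cell in two. The cells remain hereditarily oscillating, hence nonempty, and
  after \<open>k\<close> steps every sign pattern on the first \<open>k\<close> chosen indices is a cell.
\<close>
lemma ex_independent_subset:
  assumes inf: "infinite M" and osc: "hereditarily_oscillating A M S"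
  shows "\<exists>H\<subseteq>M. infinite H \<and> (\<forall>F \<sigma>. finite F \<longrightarrow> F \<subseteq> H \<longrightarrow> (\<exists>t\<in>S. \<forall>n\<in>F. t \<in> A (\<sigma> n) n))"
proof -
  define P where "P z \<longleftrightarrow> (case z of (n::nat, N, \<S>) \<Rightarrow> infinite N \<and> N \<subseteq> M \<and> finite \<S> \<and>
      (\<forall>S\<in>\<S>. hereditarily_oscillating A N S))" for z
  define Q where "Q z z' \<longleftrightarrow> (case z of (n::nat, N, \<S>) \<Rightarrow> case z' of (n', N', \<S>') \<Rightarrow>
      n' \<in> N \<and> N' \<subseteq> N \<and> N' \<subseteq> {n'<..} \<and> \<S>' = (\<lambda>(C, b). C \<inter> A b n') ` (\<S> \<times> UNIV))" for z z'
  have "\<exists>f. \<forall>k. (P (f k) \<and> (k = 0 \<longrightarrow> snd (snd (f k)) = {S})) \<and> Q (f k) (f (Suc k))"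
  proof (rule dependent_nat_choice, goal_cases)
    case 1
    then show ?case using inf osc by (intro exI[of _ "(0, M, {S})"]) (simp add: P_def)
  next
    case (2 z k)
    obtain n N \<S> where z: "z = (n, N, \<S>)" by (cases z)
    with 2 have N: "infinite N" "N \<subseteq> M" "finite \<S>"
        "\<And>C. C \<in> \<S> \<Longrightarrow> hereditarily_oscillating A N C"
      by (auto simp: P_def)
    obtain n' N' where "n' \<in> N" "N' \<subseteq> N" "infinite N'" "N' \<subseteq> {n'<..}"
        "\<forall>C\<in>\<S>. \<forall>b. hereditarily_oscillating A N' (C \<inter> A b n')"
      using split_hereditarily_oscillating[OF N(3,1,4)] by blast
    then show ?case
      using N z by (intro exI[of _ "(n', N', (\<lambda>(C, b). C \<inter> A b n') ` (\<S> \<times> UNIV))"])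
        (auto simp: P_def Q_def)
  qed
  then obtain f where f: "\<And>k. P (f k)" "snd (snd (f 0)) = {S}" "\<And>k. Q (f k) (f (Suc k))" by blast
  \<comment> \<open>The index stored in the initial state is a dummy, hence the shift by one in \<open>n\<close>.\<close>
  define n N \<S> where "n k = fst (f (Suc k))" and "N k = fst (snd (f k))"
    and "\<S> k = snd (snd (f k))" for k
  have N: "infinite (N k)" "N k \<subseteq> M" "\<And>C. C \<in> \<S> k \<Longrightarrow> hereditarily_oscillating A (N k) C" for k
    using f(1)[of k] by (auto simp: P_def N_def \<S>_def split: prod.splits)
  have step: "n k \<in> N k" "N (Suc k) \<subseteq> N k" "N (Suc k) \<subseteq> {n k<..}"
      "\<S> (Suc k) = (\<lambda>(C, b). C \<inter> A b (n k)) ` (\<S> k \<times> UNIV)" for k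
    using f(3)[of k] by (auto simp: Q_def n_def N_def \<S>_def split: prod.splits)
  have "strict_mono n"
    unfolding strict_mono_Suc_iff using step(1,3) by blast
  have cell: "\<exists>C\<in>\<S> k. \<forall>t\<in>C. t \<in> S \<and> (\<forall>j<k. t \<in> A (\<sigma> (n j)) (n j))" for k \<sigma>
  proof (induction k)
    case 0
    then show ?case using f(2) by (simp add: \<S>_def)
  next
    case (Suc k)
    then obtain C where "C \<in> \<S> k" "\<forall>t\<in>C. t \<in> S \<and> (\<forall>j<k. t \<in> A (\<sigma> (n j)) (n j))" by blast
    then show ?case
      unfolding step(4) by (intro bexI[of _ "C \<inter> A (\<sigma> (n k)) (n k)"]) (auto simp: less_Suc_eq)
  qed
  have "\<exists>t\<in>S. \<forall>m\<in>F. t \<in> A (\<sigma> m) m" if F: "finite F" "F \<subseteq> range n" for F \<sigma>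
  proof -
    obtain J where J: "finite J" "F = n ` J" using finite_subset_image[OF F] by blast
    obtain K where K: "\<And>j. j \<in> J \<Longrightarrow> j < K" using J(1) by (auto simp: finite_nat_set_iff_bounded)
    obtain C where C: "C \<in> \<S> K" "\<forall>t\<in>C. t \<in> S \<and> (\<forall>j<K. t \<in> A (\<sigma> (n j)) (n j))"
      using cell by blast
    have "C \<noteq> {}"
      using N(3)[OF C(1)] N(1)[of K] by (auto simp: hereditarily_oscillating_def)
    then obtain t where "t \<in> C" by blast
    then show ?thesis using C(2) J(2) K by blast
  qed
  moreover have "infinite (range n)"
    using \<open>strict_mono n\<close> by (simp add: finite_image_iff strict_mono_imp_inj_on)
  moreover have "range n \<subseteq> M" using step(1) N(2) by blast
  ultimately show ?thesis by blast
qed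

text \<open>
  A block over an independent index set would be separated by two functionals of norm at most one
  that take opposite sides of the gap at every index of the block.
\<close>
lemma not_hereditarily_oscillating_if_l1_blocks:
  fixes x :: "nat \<Rightarrow> 'a::real_normed_vector" and l u \<epsilon> :: real
  assumes blocks: "admits_l1_blocks \<epsilon> x" and gap: "u - l > 2 * \<epsilon>" and inf: "infinite M"
  shows "\<not> hereditarily_oscillating
    (\<lambda>b n. {x' :: 'a \<Rightarrow>\<^sub>L real.
      if b then blinfun_apply x' (x n) > u else blinfun_apply x' (x n) < l}) M {x'. norm x' \<le> 1}"
    (is "\<not> hereditarily_oscillating ?A M ?S")
proof
  assume "hereditarily_oscillating ?A M ?S"
  from ex_independent_subset[OF inf this] obtain H where H: "infinite H"
    "\<forall>F \<sigma>. finite F \<longrightarrow> F \<subseteq> H \<longrightarrow> (\<exists>t\<in>?S. \<forall>n\<in>F. t \<in> ?A (\<sigma> n) n)"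
    by (elim exE conjE)
  obtain r a i where block: "(\<Sum>\<rho>=1..r::nat. \<bar>a \<rho>\<bar>) = 1" "strict_mono_on {1..r} i"
      "i ` {1..r} \<subseteq> H" "norm (\<Sum>\<rho>=1..r. a \<rho> *\<^sub>R x (i \<rho>)) \<le> \<epsilon>"
    using blocks H(1) unfolding admits_l1_blocks_def by meson
  define v where "v = (\<Sum>\<rho>=1..r. a \<rho> *\<^sub>R x (i \<rho>))"
  have inj: "inj_on i {1..r}" using block(2) by (rule strict_mono_on_imp_inj_on)
  have pattern: "\<exists>h. norm h \<le> 1 \<and> (\<forall>\<rho>\<in>{1..r}. h \<in> ?A (\<sigma> \<rho>) (i \<rho>))" for \<sigma>
  proof -
    obtain h where "norm h \<le> 1" "\<forall>n\<in>i ` {1..r}. h \<in> ?A (\<sigma> (inv_into {1..r} i n)) n"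
      using H(2)[rule_format, of "i ` {1..r}" "\<lambda>n. \<sigma> (inv_into {1..r} i n)"] block(3) by auto
    then show ?thesis using inv_into_f_f[OF inj] by (intro exI[of _ h]) fastforce
  qed
  obtain f where f: "norm f \<le> 1" "\<And>\<rho>. \<rho> \<in> {1..r} \<Longrightarrow> f \<in> ?A (a \<rho> \<ge> 0) (i \<rho>)"
    using pattern[of "\<lambda>\<rho>. a \<rho> \<ge> 0"] by (elim exE conjE) (erule that, rule bspec)
  obtain g where g: "norm g \<le> 1" "\<And>\<rho>. \<rho> \<in> {1..r} \<Longrightarrow> g \<in> ?A (\<not> a \<rho> \<ge> 0) (i \<rho>)"
    using pattern[of "\<lambda>\<rho>. \<not> a \<rho> \<ge> 0"] by (elim exE conjE) (erule that, rule bspec)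
  have term_gap: "\<bar>a \<rho>\<bar> * (u - l) \<le> a \<rho> * (f (x (i \<rho>)) - g (x (i \<rho>)))" if "\<rho> \<in> {1..r}" for \<rho>
  proof (cases "a \<rho> \<ge> 0")
    case True
    then show ?thesis
      using f(2)[OF that] g(2)[OF that] by (auto intro!: mult_left_mono)
  next
    case False
    then have "- a \<rho> * (u - l) \<le> - a \<rho> * (g (x (i \<rho>)) - f (x (i \<rho>)))"
      using f(2)[OF that] g(2)[OF that] by (intro mult_left_mono) auto
    then show ?thesis using False by (simp add: algebra_simps)
  qed
  have "u - l = (\<Sum>\<rho>=1..r. \<bar>a \<rho>\<bar> * (u - l))"
    using block(1) by (simp flip: sum_distrib_right)
  also have "\<dots> \<le> (\<Sum>\<rho>=1..r. a \<rho> * (f (x (i \<rho>)) - g (x (i \<rho>))))"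
    by (intro sum_mono term_gap)
  also have "\<dots> = f v - g v"
    by (simp add: v_def blinfun.sum_right blinfun.scaleR_right sum_subtractf right_diff_distrib)
  also have "\<dots> \<le> 2 * \<epsilon>"
  proof -
    have "\<bar>h v\<bar> \<le> \<epsilon>" if "norm h \<le> 1" for h :: "'a \<Rightarrow>\<^sub>L real"
      using norm_blinfun[of h v] mult_right_mono[OF that norm_ge_zero[of v]] block(4)
      unfolding v_def by simp
    from this[OF f(1)] this[OF g(1)] show ?thesis by linarith
  qed
  finally show False using gap by simp
qed

lemma ex_subseq_not_crossing_gap:
  fixes x :: "nat \<Rightarrow> 'a::real_normed_vector" and l u \<epsilon> :: real
  assumes "admits_l1_blocks \<epsilon> x" and "u - l > 2 * \<epsilon>" and s: "strict_mono (s :: nat \<Rightarrow> nat)"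
  shows "\<exists>r. strict_mono r \<and> (\<forall>x' :: 'a \<Rightarrow>\<^sub>L real. norm x' \<le> 1 \<longrightarrow>
    (\<forall>\<^sub>F k in sequentially. blinfun_apply x' (x (s (r k))) \<le> u) \<or>
      (\<forall>\<^sub>F k in sequentially. l \<le> blinfun_apply x' (x (s (r k)))))"
proof -
  have inj: "inj s" using s by (rule strict_mono_imp_inj_on)
  have "infinite (range s)" using inj by (simp add: finite_image_iff)
  from not_hereditarily_oscillating_if_l1_blocks[OF assms(1,2) this]
  obtain N where N: "N \<subseteq> range s" "infinite N"
    "\<And>x' :: 'a \<Rightarrow>\<^sub>L real. norm x' \<le> 1 \<Longrightarrow>
      \<exists>b. finite {n \<in> N. if b then blinfun_apply x' (x n) > u else blinfun_apply x' (x n) < l}"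
    unfolding hereditarily_oscillating_def by (auto simp: mem_Collect_eq)
  have J: "infinite (s -` N)"
    using N(1,2) by (metis finite_imageI image_vimage_eq inf.absorb1)
  define r where "r = enumerate (s -` N)"
  have r: "strict_mono r" "\<And>k. s (r k) \<in> N"
    using J enumerate_in_set[OF J] by (auto simp: r_def strict_mono_enumerate)
  have inj_sr: "inj (s \<circ> r)"
    using s r(1) by (intro strict_mono_imp_inj_on strict_mono_o)
  have "(\<forall>\<^sub>F k in sequentially. blinfun_apply x' (x (s (r k))) \<le> u) \<or>
      (\<forall>\<^sub>F k in sequentially. l \<le> blinfun_apply x' (x (s (r k))))"
    if "norm x' \<le> 1" for x' :: "'a \<Rightarrow>\<^sub>L real"
  proof -
    from N(3)[OF that] obtain b where
      "finite {n \<in> N. if b then blinfun_apply x' (x n) > u else blinfun_apply x' (x n) < l}" by blast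
    from finite_vimageI[OF this inj_sr]
    have "finite {k. if b then blinfun_apply x' (x (s (r k))) > u else blinfun_apply x' (x (s (r k))) < l}"
      using r(2) by (simp add: vimage_def)
    then show ?thesis
      by (cases b) (simp_all add: not_le flip: cofinite_eq_sequentially add: eventually_cofinite)
  qed
  with r(1) show ?thesis by blast
qed

text \<open>
  Rational gaps suffice because any real gap contains a rational one that is only slightly
  narrower, and there are only countably many of them, so that a diagonal sequence exists.
\<close>
lemma ex_subseq_not_crossing_rational_gaps:
  fixes x :: "nat \<Rightarrow> 'a::real_normed_vector" and \<epsilon> :: real
  assumes blocks: "admits_l1_blocks \<epsilon> x"
  shows "\<exists>n :: nat \<Rightarrow> nat. strict_mono n \<and> (\<forall>(x' :: 'a \<Rightarrow>\<^sub>L real) l u :: rat.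
    norm x' \<le> 1 \<longrightarrow> of_rat u - of_rat l > 2 * \<epsilon> \<longrightarrow>
    (\<forall>\<^sub>F k in sequentially. blinfun_apply x' (x (n k)) \<le> of_rat u) \<or>
    (\<forall>\<^sub>F k in sequentially. of_rat l \<le> blinfun_apply x' (x (n k))))"
proof -
  define P where "P m s \<longleftrightarrow> (case from_nat m of (l :: rat, u :: rat) \<Rightarrow>
      of_rat u - of_rat l > 2 * \<epsilon> \<longrightarrow> (\<forall>x' :: 'a \<Rightarrow>\<^sub>L real. norm x' \<le> 1 \<longrightarrow>
        (\<forall>\<^sub>F k in sequentially. blinfun_apply x' (x (s k)) \<le> of_rat u) \<or>
        (\<forall>\<^sub>F k in sequentially. of_rat l \<le> blinfun_apply x' (x (s k)))))" for m and s :: "nat \<Rightarrow> nat"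
  interpret subseqs P
  proof
    fix m and s :: "nat \<Rightarrow> nat" assume s: "strict_mono s"
    obtain l u :: rat where lu: "from_nat m = (l, u)" by fastforce
    show "\<exists>r. strict_mono r \<and> P m (s \<circ> r)"
    proof (cases "of_rat u - of_rat l > 2 * \<epsilon>")
      case True
      then show ?thesis
        using ex_subseq_not_crossing_gap[OF blocks True s] by (simp add: P_def lu)
    next
      case False
      then show ?thesis by (intro exI[of _ id]) (simp add: P_def lu strict_mono_def)
    qed
  qed
  have stable: "P m (s \<circ> r)" if "strict_mono r" "P m s" for m s r
    using that(2) eventually_subseq[OF that(1)] unfolding P_def by (fastforce split: prod.splits)
  have "(\<forall>\<^sub>F k in sequentially. blinfun_apply x' (x (diagseq k)) \<le> of_rat u) \<or>
      (\<forall>\<^sub>F k in sequentially. of_rat l \<le> blinfun_apply x' (x (diagseq k)))"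
    if "norm x' \<le> 1" "of_rat u - of_rat l > 2 * \<epsilon>" for x' :: "'a \<Rightarrow>\<^sub>L real" and l u :: rat
  proof -
    define m where "m = to_nat (l, u)"
    have "P m (diagseq \<circ> (+) (Suc m))"
      by (rule diagseq_holds) (rule stable)
    then have "(\<forall>\<^sub>F k in sequentially. blinfun_apply x' (x (diagseq (k + Suc m))) \<le> of_rat u) \<or>
        (\<forall>\<^sub>F k in sequentially. of_rat l \<le> blinfun_apply x' (x (diagseq (k + Suc m))))"
      using that by (simp add: P_def m_def add.commute)
    then show ?thesis
      using eventually_sequentially_seg[of "\<lambda>k. blinfun_apply x' (x (diagseq k)) \<le> of_rat u" "Suc m"]
        eventually_sequentially_seg[of "\<lambda>k. of_rat l \<le> blinfun_apply x' (x (diagseq k))" "Suc m"] by blast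
  qed
  then show ?thesis using subseq_diagseq by blast
qed

text \<open>
  The bound on \<open>f\<close> keeps both limits finite; in the extended reals the difference of two equal
  infinite limits would be infinite.
\<close>
lemma limsup_minus_liminf_le:
  fixes f :: "nat \<Rightarrow> real"
  assumes bdd: "\<And>k. \<bar>f k\<bar> \<le> B"
    and gap: "\<And>l u :: rat. of_rat u - of_rat l > d \<Longrightarrow>
      (\<forall>\<^sub>F k in sequentially. f k \<le> of_rat u) \<or> (\<forall>\<^sub>F k in sequentially. of_rat l \<le> f k)"
  shows "limsup (\<lambda>k. ereal (f k)) - liminf (\<lambda>k. ereal (f k)) \<le> ereal d"
proof -
  have le: "liminf (\<lambda>k. ereal (f k)) \<le> limsup (\<lambda>k. ereal (f k))"
    by (simp add: Liminf_le_Limsup)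
  have bounds: "ereal (- B) \<le> liminf (\<lambda>k. ereal (f k))" "limsup (\<lambda>k. ereal (f k)) \<le> ereal B"
  proof -
    have "- B \<le> f k" "f k \<le> B" for k using bdd[of k] by linarith+
    then show "ereal (- B) \<le> liminf (\<lambda>k. ereal (f k))" "limsup (\<lambda>k. ereal (f k)) \<le> ereal B"
      by (simp_all add: Liminf_bounded Limsup_bounded)
  qed
  obtain L where L: "limsup (\<lambda>k. ereal (f k)) = ereal L"
    using le bounds by (cases "limsup (\<lambda>k. ereal (f k))") auto
  obtain M where M: "liminf (\<lambda>k. ereal (f k)) = ereal M"
    using le bounds L by (cases "liminf (\<lambda>k. ereal (f k))") auto
  have "L - M \<le> d"
  proof (rule ccontr)
    assume "\<not> L - M \<le> d"
    define \<eta> where "\<eta> = (L - M - d) / 2"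
    have "\<eta> > 0" using \<open>\<not> L - M \<le> d\<close> by (simp add: \<eta>_def)
    obtain u where u: "L - \<eta> < of_rat u" "of_rat u < L"
      using of_rat_dense[of "L - \<eta>" L] \<open>\<eta> > 0\<close> by auto
    obtain l where l: "M < of_rat l" "of_rat l < M + \<eta>"
      using of_rat_dense[of M "M + \<eta>"] \<open>\<eta> > 0\<close> by auto
    have "of_rat u - of_rat l > d" using u l by (simp add: \<eta>_def field_simps)
    then consider "\<forall>\<^sub>F k in sequentially. f k \<le> of_rat u" | "\<forall>\<^sub>F k in sequentially. of_rat l \<le> f k"
      using gap by blast
    then show False
    proof cases
      case 1
      then have "limsup (\<lambda>k. ereal (f k)) \<le> ereal (of_rat u)"
        by (intro Limsup_bounded) simp
      then show False using L u(2) by simp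
    next
      case 2
      then have "ereal (of_rat l) \<le> liminf (\<lambda>k. ereal (f k))"
        by (intro Liminf_bounded) simp
      then show False using M l(1) by simp
    qed
  qed
  then show ?thesis by (simp add: L M)
qed

theorem theorem3p2:
  fixes x :: "nat \<Rightarrow> 'a::banach" and \<epsilon> :: real
  assumes "bounded (range x)"
    and "\<epsilon> > 0"
    and "admits_l1_blocks \<epsilon> x"
  shows "\<exists>n :: nat \<Rightarrow> nat. strict_mono n \<and>
    (\<forall>x' :: 'a \<Rightarrow>\<^sub>L real. norm x' = 1 \<longrightarrow>
      limsup (\<lambda>k. ereal (blinfun_apply x' (x (n k))))
        - liminf (\<lambda>k. ereal (blinfun_apply x' (x (n k)))) \<le> ereal (2 * \<epsilon>))"
proof -
  obtain B where B: "\<And>k. norm (x k) \<le> B" using assms(1) by (auto simp: bounded_iff)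
  obtain n :: "nat \<Rightarrow> nat" where n: "strict_mono n"
    "\<And>(x' :: 'a \<Rightarrow>\<^sub>L real) l u :: rat. norm x' \<le> 1 \<Longrightarrow> of_rat u - of_rat l > 2 * \<epsilon> \<Longrightarrow>
      (\<forall>\<^sub>F k in sequentially. blinfun_apply x' (x (n k)) \<le> of_rat u) \<or>
      (\<forall>\<^sub>F k in sequentially. of_rat l \<le> blinfun_apply x' (x (n k)))"
    using ex_subseq_not_crossing_rational_gaps[OF assms(3)] by metis
  have "limsup (\<lambda>k. ereal (blinfun_apply x' (x (n k))))
      - liminf (\<lambda>k. ereal (blinfun_apply x' (x (n k)))) \<le> ereal (2 * \<epsilon>)"
    if "norm x' = 1" for x' :: "'a \<Rightarrow>\<^sub>L real"
  proof (rule limsup_minus_liminf_le)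
    show "\<bar>blinfun_apply x' (x (n k))\<bar> \<le> B" for k
      using norm_blinfun[of x' "x (n k)"] B[of "n k"] that by simp
  qed (use n(2) that in simp)
  with n(1) show ?thesis by blast
qed

end
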